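(* Let $G$ be a finite graph cellularly embedded in a compact, connected, orientable, boundaryless surface $\Sigma$ of genus $g\ge0$, with dual graph $G^*$ and positive coupling constants $(J_{e^*})_{e^*\in E^*}$. For every polygon configuration $P\in\mathcal P^0(G)$, $$W[\mathrm{Mono}=P]=\mathcal C_{\mathrm I}\Bigl(\prod_{e\in P}\frac{2e^{-2J_{e^*}}}{1+e^{-4J_{e^*}}}\Bigr)\sum_{\{P^*\in\mathcal P^0(G^* ):\,P\cap P^*=\emptyset\}}\Bigl(\prod_{e^*\in P^*}\frac{1-e^{-4J_{e^*}}}{1+e^{-4J_{e^*}}}\Bigr),$$ where $\mathcal C_{\mathrm I}=2^{|V^*|+2g+1}\prod_{e\in E}\cosh(2J_{e^*})$.
   Context: $G=(V,E)$, $G^*=(V^*,E^* )$, $e\mapsto e^*$ the bijection of edges and dual edges. A polygon configuration of $G$ (resp. $G^*$) is a subset of edges with even degree at every vertex; $\mathcal P^\epsilon(G)$ (resp. $\mathcal P^\epsilon(G^* )$) is the set of those with class $\epsilon\in H_1(\Sigma;\mathbb Z/2\mathbb Z)$. $P\cap P^*=\emptyset$ means there is no $e\in P$ with $e^*\in P^*$. $\mathrm{Mono}(P_{\mathrm{red}},P_{\mathrm{blue}})$ is the set of edges belonging to exactly one of $P_{\mathrm{red}},P_{\mathrm{blue}}$. $W[\mathrm{Mono}=P]$ is the contribution of pairs with $\mathrm{Mono}=P$ to the double Ising partition function: $$W[\mathrm{Mono}=P]=\sum_{\epsilon\in H_1(\Sigma;\mathbb Z/2\mathbb Z)}\ \sum_{\substack{(P_{\mathrm{red}},P_{\mathrm{blue}})\in\mathcal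 P^\epsilon(G)\times\mathcal P^\epsilon(G)\\ \mathrm{Mono}(P_{\mathrm{red}},P_{\mathrm{blue}})=P}}\Bigl(2\prod_{e\in E}e^{J_{e^*}}\Bigr)^2\prod_{e\in P_{\mathrm{red}}}e^{-2J_{e^*}}\prod_{e\in P_{\mathrm{blue}}}e^{-2J_{e^*}} .$$ *)

theory Defs
  imports
    Complex_Main
    "HOL-Algebra.Coset"
    "HOL-Combinatorics.Orbits"
    "Graph_Theory.Bidirected_Digraph"
    "Graph_Theory.Digraph_Component"
begin

section \<open>Graphs cellularly embedded in closed oriented surfaces\<close>

text \<open>
  A cellular embedding of a finite graph in a compact, connected, oriented surface without
  boundary is given by a rotation system (combinatorial map). Every undirected edge is a pair
  of opposite arcs, exchanged by the fixed point free involution \<open>arc_rev\<close>, and \<open>rot\<close> sends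
  an arc to the next arc with the same tail, in the sense of rotation (say clockwise) fixed by
  the orientation. Loops and multiple edges are allowed. Surfaces obtained from rotation
  systems are exactly the orientable ones.
\<close>

record ('a, 'b) rotation_system =
  underlying :: "('a, 'b) pre_digraph"
  arc_rev :: "'b \<Rightarrow> 'b"
  rot :: "'b \<Rightarrow> 'b"

definition cellularly_embedded :: "('a, 'b) rotation_system \<Rightarrow> bool" where
  "cellularly_embedded M \<longleftrightarrow>
     fin_digraph (underlying M) \<and>
     bidirected_digraph (underlying M) (arc_rev M) \<and>
     Digraph_Component.connected (underlying M) \<and>
     rot M permutes arcs (underlying M) \<and>
     (\<forall>v \<in> verts (underlying M). out_arcs (underlying M) v \<noteq> {} \<longrightarrow>
        cyclic_on (rot M) (out_arcs (underlying M) v))"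

definition edges :: "('a, 'b) rotation_system \<Rightarrow> 'b set set" where
  "edges M = (\<lambda>a. {a, arc_rev M a}) ` arcs (underlying M)"

text \<open>
  The next arc along the boundary of the face on the left of an arc: turn around at its head
  and take the next arc clockwise.
\<close>

definition face_succ :: "('a, 'b) rotation_system \<Rightarrow> 'b \<Rightarrow> 'b" where
  "face_succ M = rot M \<circ> arc_rev M"

text \<open>
  A face is represented by the set of arcs having it on their left. The only connected graph
  without arcs is a single vertex on the sphere, which has one face, represented by \<open>{}\<close>.
\<close>

definition face_of :: "('a, 'b) rotation_system \<Rightarrow> 'b \<Rightarrow> 'b set" where
  "face_of M a = orbit (face_succ M) a"

definition faces :: "('a, 'b) rotation_system \<Rightarrow> 'b set set" where
  "faces M = (if arcs (underlying M) = {} then {{}} else face_of M ` arcs (underlying M))"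

definition euler_char :: "('a, 'b) rotation_system \<Rightarrow> int" where
  "euler_char M = int (card (verts (underlying M))) - int (card (edges M)) + int (card (faces M))"

definition has_genus :: "('a, 'b) rotation_system \<Rightarrow> nat \<Rightarrow> bool" where
  "has_genus M g \<longleftrightarrow> euler_char M = 2 - 2 * int g"

text \<open>
  The dual graph has the faces as vertices. The dual of an arc \<open>a\<close> crosses \<open>a\<close> from its left
  to its right; it is again called \<open>a\<close>, so that the arc reversal is unchanged. Around the dual
  vertex of a face, the dual arcs are arranged like the arcs along the boundary of that face.
  (This is counterclockwise: the dual carries the opposite orientation, which is irrelevant
  for homology modulo 2. The orbits of \<open>face_succ (dual_map M) = rot M\<close> are the sets
  of arcs around the vertices of the original graph.)
\<close>

definition dual_map :: "('a, 'b) rotation_system \<Rightarrow> ('b set, 'b) rotation_system" where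
  "dual_map M =
     \<lparr> underlying =
         \<lparr> verts = faces M, arcs = arcs (underlying M),
           tail = face_of M, head = face_of M \<circ> arc_rev M \<rparr>,
       arc_rev = arc_rev M,
       rot = face_succ M \<rparr>"

text \<open>
  The bijection between edges and dual edges. As an arc and its dual share their name, it maps
  a pair of opposite arcs to itself.
\<close>

definition dual_edge :: "'b set \<Rightarrow> 'b set" where
  "dual_edge e = e"


section \<open>First homology modulo 2\<close>

text \<open>
  Chains modulo 2 are sets of cells, added by symmetric difference. \<open>H1 M\<close> is the cellular
  homology group of the surface for the cell decomposition given by \<open>M\<close>.
\<close>

text \<open>Counting arcs rather than edges makes a loop contribute 2 to the degree.\<close>

definition degree_in :: "('a, 'b) rotation_system \<Rightarrow> 'b set set \<Rightarrow> 'a \<Rightarrow> nat" where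
  "degree_in M P v = card {a \<in> out_arcs (underlying M) v. {a, arc_rev M a} \<in> P}"

definition polygon_configs :: "('a, 'b) rotation_system \<Rightarrow> 'b set set set" where
  "polygon_configs M =
     {P. P \<subseteq> edges M \<and> (\<forall>v \<in> verts (underlying M). even (degree_in M P v))}"

definition cycle_group :: "('a, 'b) rotation_system \<Rightarrow> 'b set set monoid" where
  "cycle_group M = \<lparr> carrier = polygon_configs M, monoid.mult = (\<lambda>P Q. sym_diff P Q), one = {} \<rparr>"

definition boundary :: "('a, 'b) rotation_system \<Rightarrow> 'b set set \<Rightarrow> 'b set set" where
  "boundary M S = {e \<in> edges M. odd (card {a \<in> e. face_of M a \<in> S})}"

definition boundaries :: "('a, 'b) rotation_system \<Rightarrow> 'b set set set" where
  "boundaries M = boundary M ` Pow (faces M)"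

definition H1 :: "('a, 'b) rotation_system \<Rightarrow> 'b set set set monoid" where
  "H1 M = cycle_group M Mod boundaries M"

definition homology_class :: "('a, 'b) rotation_system \<Rightarrow> 'b set set \<Rightarrow> 'b set set set" where
  "homology_class M P = boundaries M #>\<^bsub>cycle_group M\<^esub> P"

definition polygons_of_class ::
    "('a, 'b) rotation_system \<Rightarrow> 'b set set set \<Rightarrow> 'b set set set" where
  "polygons_of_class M \<epsilon> = {P \<in> polygon_configs M. homology_class M P = \<epsilon>}"


section \<open>The double Ising model\<close>

definition monochromatic :: "'e set \<Rightarrow> 'e set \<Rightarrow> 'e set" where
  "monochromatic P_red P_blue = sym_diff P_red P_blue"

definition W_Mono ::
    "('a, 'b) rotation_system \<Rightarrow> ('b set \<Rightarrow> real) \<Rightarrow> 'b set set \<Rightarrow> real" where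
  "W_Mono M J P =
     (\<Sum>\<epsilon> \<in> carrier (H1 M).
        \<Sum>(P_red, P_blue) \<in> {(P_red, P_blue) \<in> polygons_of_class M \<epsilon> \<times> polygons_of_class M \<epsilon>.
                             monochromatic P_red P_blue = P}.
          (2 * (\<Prod>e \<in> edges M. exp (J (dual_edge e))))\<^sup>2
          * (\<Prod>e \<in> P_red. exp (- 2 * J (dual_edge e)))
          * (\<Prod>e \<in> P_blue. exp (- 2 * J (dual_edge e))))"

text \<open>The number of dual vertices is the number of faces.\<close>

definition C_Ising ::
    "('a, 'b) rotation_system \<Rightarrow> nat \<Rightarrow> ('b set \<Rightarrow> real) \<Rightarrow> real" where
  "C_Ising M g J =
     2 ^ (card (verts (underlying (dual_map M))) + 2 * g + 1)
     * (\<Prod>e \<in> edges M. cosh (2 * J (dual_edge e)))"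

end

theory Submission
  imports Defs
begin

text \<open>
  If \<open>P\<close> is a boundary, then the pairs of polygon configurations of equal homology class with
  \<open>Mono = P\<close> are exactly the pairs \<open>(R, R + P)\<close>, where \<open>R\<close> runs through all polygon
  configurations of the graph, whatever their class. An edge of \<open>P\<close> lies in exactly one of \<open>R\<close>
  and \<open>R + P\<close>, and any other edge lies in both or in neither. So, with \<open>x e = exp (- 4 * J e)\<close>,
  the weight is a constant times \<open>\<Sum>R. \<Prod>e\<in>R - P. x e\<close>, that is, times \<open>\<Sum>R. \<Prod>e\<in>R. y e\<close>, where
  \<open>y = 1\<close> on \<open>P\<close> and \<open>y = x\<close> off \<open>P\<close> (\<open>W_Mono_single_sum\<close>, \<open>prod_times_prod_sym_diff\<close>).

  On the dual side, the faces of the dual map are the stars of the vertices of the graph, so that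
  the boundaries of the dual map are the cuts of the graph (\<open>boundaries_dual\<close>). Cuts have even
  degree at each face, so the dual polygon configurations of trivial class are the cuts as well
  (\<open>trivial_dual_polygons\<close>).

  The two sums are related by the high-temperature expansion of an Ising model with spins on the
  vertices of the graph (\<open>high_temperature_expansion\<close>). Let \<open>\<sigma> e\<close> be the product of the two spins
  at the ends of \<open>e\<close>; the edges with \<open>\<sigma> e = - 1\<close> form the cut of the set of minus spins. Expand
  \<open>\<Prod>e. 1 + y e * \<sigma> e\<close> over sets of edges and sum over all spins: precisely the polygon
  configurations survive, each with coefficient \<open>2 ^ |V|\<close>. The same product, grouped by cuts, is
  \<open>\<Prod>e. 1 + y e\<close> times the product of \<open>(1 - y e) / (1 + y e)\<close> over the cut. The value \<open>y = 1\<close> on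
  \<open>P\<close> removes the cuts that meet \<open>P\<close>, which is the condition that \<open>P\<close> and the dual
  configuration be disjoint. As the graph is connected, each cut comes from exactly two spin
  configurations (\<open>sum_over_cuts\<close>). Euler's formula turns the remaining power of two into that
  of \<open>C_Ising\<close>.
\<close>

section \<open>Symmetric differences and signs\<close>

lemma odd_card_sym_diff:
  assumes "finite A" "finite B"
  shows "odd (card (sym_diff A B)) \<longleftrightarrow> odd (card A) \<noteq> odd (card B)"
proof -
  have "card (sym_diff A B) = card (A - B) + card (B - A)"
    using assms by (intro card_Un_disjoint) auto
  moreover have "card A = card (A - B) + card (A \<inter> B)"
    using assms by (subst card_Un_disjoint[symmetric]) (auto intro: arg_cong[where f = card])
  moreover have "card B = card (B - A) + card (A \<inter> B)"
    using assms by (subst card_Un_disjoint[symmetric]) (auto intro: arg_cong[where f = card])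
  ultimately show ?thesis by auto
qed

lemma prod_signs:
  assumes "finite A"
  shows "(\<Prod>a\<in>A. if Q a then - 1 else 1 :: real) = (if odd (card {a \<in> A. Q a}) then - 1 else 1)"
proof -
  have "(\<Prod>a\<in>A. if Q a then - 1 else 1 :: real) = (\<Prod>a\<in>{a \<in> A. Q a}. - 1)"
    using assms by (simp only: prod.inter_filter)
  also have "\<dots> = (- 1) ^ card {a \<in> A. Q a}" by simp
  finally show ?thesis by (cases "odd (card {a \<in> A. Q a})") simp_all
qed

text \<open>
  The sum over spin configurations factorizes over the vertices, and a vertex \<open>v\<close> contributes
  \<open>(- 1) ^ d v + 1\<close>.
  With \<open>d\<close> the degrees in an edge set, only polygon configurations survive.
\<close>

lemma sum_sign_powers:
  assumes "finite V"
  shows "(\<Sum>S\<in>Pow V. \<Prod>v\<in>V. (if v \<in> S then - 1 else 1 :: real) ^ d v)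
    = (if \<forall>v\<in>V. even (d v) then 2 ^ card V else 0)"
proof -
  have "(\<Prod>v\<in>V. (if v \<in> S then - 1 else 1 :: real) ^ d v)
      = (\<Prod>v\<in>S. (- 1) ^ d v) * (\<Prod>v\<in>V - S. 1)" if "S \<in> Pow V" for S
  proof -
    have "(\<Prod>v\<in>V. (if v \<in> S then - 1 else 1 :: real) ^ d v)
        = (\<Prod>v\<in>V. if v \<in> S then (- 1) ^ d v else 1)"
      by (intro prod.cong) auto
    also have "\<dots> = (\<Prod>v\<in>V \<inter> S. (- 1) ^ d v)"
      using assms by (simp add: prod.inter_restrict)
    finally show ?thesis using that by (simp add: Int_absorb1)
  qed
  then have "(\<Sum>S\<in>Pow V. \<Prod>v\<in>V. (if v \<in> S then - 1 else 1 :: real) ^ d v)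
      = (\<Prod>v\<in>V. (- 1) ^ d v + 1)"
    using assms by (simp add: prod_add)
  also have "\<dots> = (if \<forall>v\<in>V. even (d v) then 2 ^ card V else 0)"
  proof (cases "\<forall>v\<in>V. even (d v)")
    case True
    then have "(\<Prod>v\<in>V. (- 1 :: real) ^ d v + 1) = (\<Prod>v\<in>V. 2)"
      by (intro prod.cong) auto
    with True show ?thesis by simp
  next
    case False
    then obtain v where "v \<in> V" "(- 1 :: real) ^ d v + 1 = 0" by auto
    with assms have "(\<Prod>v\<in>V. (- 1 :: real) ^ d v + 1) = 0" by (intro prod_zero) auto
    with False show ?thesis by simp
  qed
  finally show ?thesis .
qed

text \<open>
  Elements of \<open>P\<close> lie in exactly one of \<open>R\<close> and \<open>sym_diff R P\<close>, elements of \<open>R - P\<close> in both.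
\<close>

lemma prod_times_prod_sym_diff:
  fixes k :: "'e \<Rightarrow> real"
  assumes "finite R" "finite P"
  shows "prod k R * prod k (sym_diff R P) = prod k P * (\<Prod>e\<in>R - P. k e ^ 2)"
proof -
  have "prod k R = prod k (R \<inter> P) * prod k (R - P)"
    using assms by (subst prod.Int_Diff[of R _ P]) auto
  moreover have "prod k P = prod k (R \<inter> P) * prod k (P - R)"
    using assms by (subst prod.Int_Diff[of P _ R]) (auto simp: Int_commute)
  moreover have "prod k (sym_diff R P) = prod k (R - P) * prod k (P - R)"
    using assms by (intro prod.union_disjoint) auto
  ultimately show ?thesis by (simp add: prod.distrib power2_eq_square)
qed

section \<open>Homology classes as cosets of the boundaries\<close>

text \<open>
  The boundary operator is additive modulo 2, so its image is a subgroup.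
\<close>

lemma sym_diff_in_boundaries:
  assumes "A \<in> boundaries M" "B \<in> boundaries M"
  shows "sym_diff A B \<in> boundaries M"
proof -
  from assms obtain S T where S: "S \<subseteq> faces M" "A = boundary M S"
    and T: "T \<subseteq> faces M" "B = boundary M T"
    by (auto simp: boundaries_def)
  have "odd (card {a \<in> e. face_of M a \<in> sym_diff S T}) \<longleftrightarrow>
      odd (card {a \<in> e. face_of M a \<in> S}) \<noteq> odd (card {a \<in> e. face_of M a \<in> T})"
    if "e \<in> edges M" for e
  proof -
    from that have "finite e" by (auto simp: edges_def)
    moreover have "{a \<in> e. face_of M a \<in> sym_diff S T}
        = sym_diff {a \<in> e. face_of M a \<in> S} {a \<in> e. face_of M a \<in> T}"
      by auto
    ultimately show ?thesis by (simp add: odd_card_sym_diff)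
  qed
  then have "sym_diff A B = boundary M (sym_diff S T)"
    unfolding S T boundary_def by blast
  with S T show ?thesis by (auto simp: boundaries_def)
qed

lemma empty_in_boundaries: "{} \<in> boundaries M"
  unfolding boundaries_def by (intro image_eqI[where x = "{}"]) (auto simp: boundary_def)

lemma homology_class_eq: "homology_class M P = (\<lambda>B. sym_diff B P) ` boundaries M"
  by (auto simp: homology_class_def r_coset_def cycle_group_def)

lemma homology_class_sym_diff_boundary:
  assumes "P \<in> boundaries M"
  shows "homology_class M (sym_diff R P) = homology_class M R"
proof -
  have "homology_class M (sym_diff R P) = (\<lambda>B. sym_diff B R) ` (\<lambda>B. sym_diff B P) ` boundaries M"
    unfolding homology_class_eq image_image by (intro image_cong refl) auto
  also have "(\<lambda>B. sym_diff B P) ` boundaries M = boundaries M"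
  proof
    show "(\<lambda>B. sym_diff B P) ` boundaries M \<subseteq> boundaries M"
      using assms by (auto intro: sym_diff_in_boundaries)
    show "boundaries M \<subseteq> (\<lambda>B. sym_diff B P) ` boundaries M"
    proof
      fix B assume "B \<in> boundaries M"
      then have "sym_diff B P \<in> boundaries M" using assms by (rule sym_diff_in_boundaries)
      moreover have "B = sym_diff (sym_diff B P) P" by auto
      ultimately show "B \<in> (\<lambda>B. sym_diff B P) ` boundaries M" by (rule rev_image_eqI)
    qed
  qed
  finally show ?thesis by (simp add: homology_class_eq)
qed

lemma polygons_of_trivial_class:
  "polygons_of_class M \<one>\<^bsub>H1 M\<^esub> = polygon_configs M \<inter> boundaries M"
proof -
  have "homology_class M P = boundaries M \<longleftrightarrow> P \<in> boundaries M" for P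
  proof
    assume "homology_class M P = boundaries M"
    moreover have "P \<in> homology_class M P"
      unfolding homology_class_eq using empty_in_boundaries by (rule rev_image_eqI) auto
    ultimately show "P \<in> boundaries M" by simp
  next
    assume "P \<in> boundaries M"
    then have "homology_class M (sym_diff {} P) = homology_class M {}"
      by (rule homology_class_sym_diff_boundary)
    then show "homology_class M P = boundaries M" by (simp add: homology_class_eq)
  qed
  then show ?thesis by (auto simp: polygons_of_class_def H1_def FactGroup_def)
qed

lemma carrier_H1: "carrier (H1 M) = homology_class M ` polygon_configs M"
  by (auto simp: H1_def FactGroup_def RCOSETS_def homology_class_def cycle_group_def)

section \<open>Cuts of the graph\<close>

locale cellular_embedding =
  fixes M :: "('a, 'b) rotation_system"
  assumes cellularly_embedded: "cellularly_embedded M"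
begin

sublocale fin_digraph "underlying M"
  using cellularly_embedded by (simp add: cellularly_embedded_def)

sublocale bidirected_digraph "underlying M" "arc_rev M"
  using cellularly_embedded by (simp add: cellularly_embedded_def)

abbreviation V :: "'a set" where "V \<equiv> verts (underlying M)"
abbreviation src :: "'b \<Rightarrow> 'a" where "src \<equiv> tail (underlying M)"
abbreviation tgt :: "'b \<Rightarrow> 'a" where "tgt \<equiv> head (underlying M)"

text \<open>
  Edges are sets of arcs and each end of an edge is the source of one of its arcs; a parity
  count thus treats loops, which are in no cut, like all other edges.
\<close>

definition cut :: "'a set \<Rightarrow> 'b set set" where
  "cut S = {e \<in> edges M. odd (card {a \<in> e. src a \<in> S})}"

lemma strongly_connected: "strongly_connected (underlying M)"
  using cellularly_embedded symmetric_connected_imp_strongly_connected[OF sym_arcs]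
  by (simp add: cellularly_embedded_def)

lemma V_nonempty: "V \<noteq> {}"
  using strongly_connected by (simp add: strongly_connected_def)

lemma finite_edges: "finite (edges M)"
  by (simp add: edges_def)

lemma edge_subset_arcs: "e \<in> edges M \<Longrightarrow> e \<subseteq> arcs (underlying M)"
  by (auto simp: edges_def)

lemma finite_edge: "e \<in> edges M \<Longrightarrow> finite e"
  by (auto simp: edges_def)

lemma edge_eq_of_arc_mem:
  assumes "e \<in> edges M" "a \<in> e"
  shows "e = {a, arc_rev M a}"
  using assms by (auto simp: edges_def)

lemma finite_polygon_configs: "finite (polygon_configs M)"
  using finite_edges by (rule finite_subset[rotated, OF finite_Pow_iff[THEN iffD2]])
    (auto simp: polygon_configs_def)

lemma sym_diff_in_polygon_configs:
  assumes "A \<in> polygon_configs M" "B \<in> polygon_configs M"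
  shows "sym_diff A B \<in> polygon_configs M"
proof -
  have "even (degree_in M (sym_diff A B) v)" if "v \<in> V" for v
  proof -
    let ?D = "\<lambda>R. {a \<in> out_arcs (underlying M) v. {a, arc_rev M a} \<in> R}"
    have "?D (sym_diff A B) = sym_diff (?D A) (?D B)" by auto
    moreover have "finite (?D R)" for R by simp
    ultimately have "odd (card (?D (sym_diff A B))) \<longleftrightarrow> odd (card (?D A)) \<noteq> odd (card (?D B))"
      by (simp only: odd_card_sym_diff)
    with assms that show ?thesis by (auto simp: polygon_configs_def degree_in_def)
  qed
  with assms show ?thesis by (auto simp: polygon_configs_def)
qed

lemma edge_in_cut_iff:
  assumes "a \<in> arcs (underlying M)"
  shows "{a, arc_rev M a} \<in> cut S \<longleftrightarrow> (src a \<in> S) \<noteq> (tgt a \<in> S)"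
proof -
  have "{b \<in> {a, arc_rev M a}. src b \<in> S}
      = (if src a \<in> S then {a} else {}) \<union> (if tgt a \<in> S then {arc_rev M a} else {})"
    using assms by auto
  moreover have "a \<noteq> arc_rev M a" using assms arev_neq by metis
  ultimately have "odd (card {b \<in> {a, arc_rev M a}. src b \<in> S}) \<longleftrightarrow> (src a \<in> S) \<noteq> (tgt a \<in> S)"
    by simp
  moreover have "{a, arc_rev M a} \<in> edges M" using assms by (auto simp: edges_def)
  ultimately show ?thesis by (simp add: cut_def)
qed

text \<open>
  Two vertex sets with the same cut either agree at both ends of an arc or differ at both ends.
  By connectedness the same alternative holds at all vertices.
\<close>

lemma cut_eq_iff:
  assumes "S \<subseteq> V" "T \<subseteq> V"
  shows "cut T = cut S \<longleftrightarrow> T = S \<or> T = V - S"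
proof
  assume eq: "cut T = cut S"
  let ?agree = "\<lambda>v. v \<in> T \<longleftrightarrow> v \<in> S"
  have step: "?agree u = ?agree v" if uv: "u \<rightarrow>\<^bsub>underlying M\<^esub> v" for u v
  proof -
    from uv obtain a where a: "a \<in> arcs (underlying M)" "src a = u" "tgt a = v"
      by (auto simp: arcs_ends_conv)
    from eq have "{a, arc_rev M a} \<in> cut T \<longleftrightarrow> {a, arc_rev M a} \<in> cut S" by simp
    with a show ?thesis by (auto simp: edge_in_cut_iff)
  qed
  have const: "?agree u = ?agree v" if "u \<in> V" "v \<in> V" for u v
  proof -
    from strongly_connected that have "u \<rightarrow>\<^sup>*\<^bsub>underlying M\<^esub> v"
      by (auto simp: strongly_connected_def)
    then show ?thesis by (induction rule: converse_reachable_induct) (auto dest: step)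
  qed
  from V_nonempty obtain w where w: "w \<in> V" by auto
  show "T = S \<or> T = V - S"
  proof (cases "?agree w")
    case True
    with const[OF w] assms have "T = S" by blast
    then show ?thesis ..
  next
    case False
    with const[OF w] assms have "T = V - S" by blast
    then show ?thesis ..
  qed
next
  have "cut (V - S) = cut S"
  proof (rule Set.set_eqI)
    fix e
    show "e \<in> cut (V - S) \<longleftrightarrow> e \<in> cut S"
    proof (cases "e \<in> edges M")
      case True
      then obtain a where a: "a \<in> arcs (underlying M)" "e = {a, arc_rev M a}"
        by (auto simp: edges_def)
      then show ?thesis by (auto simp: edge_in_cut_iff)
    qed (simp add: cut_def)
  qed
  then show "T = S \<or> T = V - S \<Longrightarrow> cut T = cut S" by auto
qed

text \<open>
  The two vertex sets with a given cut are complementary, and they are distinct because the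
  graph has a vertex.
\<close>

lemma sum_over_cuts:
  fixes h :: "'b set set \<Rightarrow> real"
  shows "(\<Sum>S\<in>Pow V. h (cut S)) = 2 * (\<Sum>Q\<in>cut ` Pow V. h Q)"
proof -
  have "(\<Sum>S\<in>Pow V. h (cut S)) = (\<Sum>Q\<in>cut ` Pow V. \<Sum>S\<in>{S \<in> Pow V. cut S = Q}. h (cut S))"
    by (rule sum.image_gen) simp
  also have "\<dots> = (\<Sum>Q\<in>cut ` Pow V. 2 * h Q)"
  proof (intro sum.cong refl)
    fix Q assume "Q \<in> cut ` Pow V"
    then obtain S where S: "S \<subseteq> V" "Q = cut S" by auto
    have compl: "cut (V - S) = cut S" using S cut_eq_iff[of S "V - S"] Diff_subset by blast
    have "T \<in> Pow V \<and> cut T = Q \<longleftrightarrow> T = S \<or> T = V - S" for T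
      unfolding S(2) using S(1) compl cut_eq_iff[OF S(1), of T] by blast
    then have "{T \<in> Pow V. cut T = Q} = {S, V - S}" by blast
    moreover have "S \<noteq> V - S" using S V_nonempty by blast
    moreover note compl S(2)
    ultimately show "(\<Sum>T\<in>{T \<in> Pow V. cut T = Q}. h (cut T)) = 2 * h Q"
      by simp
  qed
  finally show ?thesis by (simp add: sum_distrib_left)
qed

section \<open>Boundaries of the dual map\<close>

lemma edges_dual: "edges (dual_map M) = edges M"
  by (simp add: edges_def dual_map_def)

lemma face_of_dual:
  assumes "a \<in> arcs (underlying M)"
  shows "face_of (dual_map M) a = out_arcs (underlying M) (src a)"
proof -
  have "face_succ (dual_map M) = rot M"
    by (auto simp: face_succ_def dual_map_def)
  moreover have "a \<in> out_arcs (underlying M) (src a)" using assms by simp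
  moreover from this assms have "cyclic_on (rot M) (out_arcs (underlying M) (src a))"
    using cellularly_embedded tail_in_verts[OF assms]
    unfolding cellularly_embedded_def by blast
  ultimately show ?thesis by (auto simp: face_of_def cyclic_on_alldef)
qed

lemma boundary_dual:
  "boundary (dual_map M) F = cut {v. out_arcs (underlying M) v \<in> F}"
proof -
  have "{a \<in> e. face_of (dual_map M) a \<in> F}
      = {a \<in> e. src a \<in> {v. out_arcs (underlying M) v \<in> F}}" if "e \<in> edges M" for e
    using edge_subset_arcs[OF that] by (auto simp: face_of_dual)
  then show ?thesis by (auto simp: boundary_def cut_def edges_dual)
qed

lemma cut_cong:
  assumes "\<And>a. a \<in> arcs (underlying M) \<Longrightarrow> src a \<in> S \<longleftrightarrow> src a \<in> T"
  shows "cut S = cut T"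
proof -
  have "{a \<in> e. src a \<in> S} = {a \<in> e. src a \<in> T}" if "e \<in> edges M" for e
    using edge_subset_arcs[OF that] assms by auto
  then show ?thesis by (auto simp: cut_def)
qed

text \<open>
  The faces of the dual map are the sets of arcs leaving the vertices, so a set of dual faces
  amounts to a set of vertices, and its boundary to a cut. In the one-vertex map without arcs
  both sides are \<open>{{}}\<close>.
\<close>

lemma boundaries_dual: "boundaries (dual_map M) = cut ` Pow V"
proof (intro equalityI subsetI)
  fix Q assume "Q \<in> boundaries (dual_map M)"
  then obtain F where "Q = cut {v. out_arcs (underlying M) v \<in> F}"
    by (auto simp: boundaries_def boundary_dual)
  also have "\<dots> = cut {v \<in> V. out_arcs (underlying M) v \<in> F}"
    by (rule cut_cong) auto
  finally show "Q \<in> cut ` Pow V" by auto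
next
  fix Q assume "Q \<in> cut ` Pow V"
  then obtain S where S: "S \<subseteq> V" "Q = cut S" by auto
  define F where "F = face_of (dual_map M) ` {a \<in> arcs (underlying M). src a \<in> S}"
  have "src a \<in> S \<longleftrightarrow> out_arcs (underlying M) (src a) \<in> F" if a: "a \<in> arcs (underlying M)" for a
  proof
    assume "src a \<in> S"
    then show "out_arcs (underlying M) (src a) \<in> F"
      using a unfolding F_def by (auto simp: face_of_dual[symmetric])
  next
    assume "out_arcs (underlying M) (src a) \<in> F"
    then obtain b where b: "b \<in> arcs (underlying M)" "src b \<in> S"
      "out_arcs (underlying M) (src a) = out_arcs (underlying M) (src b)"
      by (auto simp: F_def face_of_dual)
    moreover have "a \<in> out_arcs (underlying M) (src a)" using a by simp
    ultimately show "src a \<in> S" by simp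
  qed
  then have "Q = boundary (dual_map M) F"
    unfolding S boundary_dual by (intro cut_cong) simp
  moreover have "F \<subseteq> faces (dual_map M)"
    by (auto simp: F_def faces_def dual_map_def)
  ultimately show "Q \<in> boundaries (dual_map M)" by (auto simp: boundaries_def)
qed

lemma face_succ_permutes: "face_succ M permutes arcs (underlying M)"
  unfolding face_succ_def using cellularly_embedded arev_permutes_arcs
  by (auto simp: cellularly_embedded_def intro: permutes_compose)

lemma permutation_face_succ: "permutation (face_succ M)"
  using face_succ_permutes finite_arcs unfolding permutation_permutes by blast

lemma tail_face_succ:
  assumes "a \<in> arcs (underlying M)"
  shows "src (face_succ M a) = tgt a"
proof -
  let ?b = "arc_rev M a"
  have b: "?b \<in> arcs (underlying M)" using assms by simp
  then have "out_arcs (underlying M) (src ?b) \<noteq> {}" by auto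
  then have "cyclic_on (rot M) (out_arcs (underlying M) (src ?b))"
    using cellularly_embedded tail_in_verts[OF b] by (simp add: cellularly_embedded_def)
  then have "rot M ?b \<in> out_arcs (underlying M) (src ?b)"
    using b cyclic_on_funpow_in[of "rot M" "out_arcs (underlying M) (src ?b)" ?b 1] by simp
  then show ?thesis using assms by (simp add: face_succ_def)
qed

text \<open>
  The boundary of a face is a closed walk, so it passes between \<open>S\<close> and its complement an even
  number of times. In terms of arcs, \<open>face_succ\<close> permutes the arcs of the
  face and maps those with target in \<open>S\<close> onto those with source in \<open>S\<close>, so there are equally
  many of both kinds.
\<close>

lemma cut_in_polygon_configs_dual: "cut S \<in> polygon_configs (dual_map M)"
proof -
  have "even (degree_in (dual_map M) (cut S) f)" if f: "f \<in> faces M" for f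
  proof (cases "arcs (underlying M) = {}")
    case True
    then show ?thesis by (simp add: degree_in_def dual_map_def out_arcs_def)
  next
    case False
    with f obtain a where a: "a \<in> arcs (underlying M)" "f = face_of M a"
      by (auto simp: faces_def)
    let ?s = "face_succ M"
    have face_eq: "face_of M b = f \<longleftrightarrow> b \<in> f" for b
    proof
      show "face_of M b = f \<Longrightarrow> b \<in> f"
        using permutation_self_in_orbit[OF permutation_face_succ] by (auto simp: face_of_def)
      assume "b \<in> f"
      then have "b \<in> orbit ?s a" by (simp add: a face_of_def)
      then show "face_of M b = f"
        unfolding a face_of_def
        using permutation_self_in_orbit[OF permutation_face_succ]
        by (blast intro: orbit_trans orbit_swap)
    qed
    have f_arcs: "f \<subseteq> arcs (underlying M)"
      unfolding a face_of_def by (rule permutes_orbit_subset[OF face_succ_permutes a(1)])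
    then have fin: "finite f" by (rule finite_subset) simp
    have "?s ` f \<subseteq> f" by (auto simp: a face_of_def intro: orbit.step)
    moreover have inj: "inj_on ?s f" using permutes_inj_on[OF face_succ_permutes] .
    ultimately have im: "?s ` f = f" using fin by (simp add: endo_inj_surj)
    let ?A = "{b \<in> f. src b \<in> S}" and ?B = "{b \<in> f. tgt b \<in> S}"
    have "?s ` ?B = ?A"
    proof (intro equalityI subsetI)
      fix c assume "c \<in> ?s ` ?B"
      then show "c \<in> ?A" using im f_arcs by (auto simp: tail_face_succ)
    next
      fix c assume c: "c \<in> ?A"
      then have "c \<in> ?s ` f" by (simp add: im)
      then obtain b where "b \<in> f" "c = ?s b" by auto
      with c f_arcs show "c \<in> ?s ` ?B" by (auto simp: tail_face_succ)
    qed
    then have card: "card ?A = card ?B"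
      using card_image[OF inj_on_subset[OF inj, of ?B]] by auto
    have "{b \<in> out_arcs (underlying (dual_map M)) f. {b, arc_rev (dual_map M) b} \<in> cut S}
        = {b \<in> f. {b, arc_rev M b} \<in> cut S}"
      using f_arcs by (auto simp: dual_map_def face_eq)
    also have "\<dots> = sym_diff ?A ?B"
      using f_arcs by (auto simp: edge_in_cut_iff)
    finally have "odd (degree_in (dual_map M) (cut S) f) \<longleftrightarrow> odd (card ?A) \<noteq> odd (card ?B)"
      using fin by (simp add: degree_in_def odd_card_sym_diff)
    with card show ?thesis by simp
  qed
  moreover have "verts (underlying (dual_map M)) = faces M" by (simp add: dual_map_def)
  ultimately show ?thesis by (auto simp: polygon_configs_def edges_dual cut_def)
qed

lemma trivial_dual_polygons: "polygons_of_class (dual_map M) \<one>\<^bsub>H1 (dual_map M)\<^esub> = cut ` Pow V"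
  unfolding polygons_of_trivial_class boundaries_dual using cut_in_polygon_configs_dual by auto

section \<open>High-temperature expansion\<close>

text \<open>
  The product of the spins at the two ends of an edge, when the spins in \<open>S\<close> are \<open>- 1\<close>.
\<close>

definition edge_sign :: "'a set \<Rightarrow> 'b set \<Rightarrow> real" where
  "edge_sign S e = (\<Prod>a\<in>e. if src a \<in> S then - 1 else 1)"

lemma edge_sign_eq: "e \<in> edges M \<Longrightarrow> edge_sign S e = (if e \<in> cut S then - 1 else 1)"
  by (simp add: edge_sign_def prod_signs finite_edge cut_def)

text \<open>
  Collecting spins by vertices: the spin at \<open>v\<close> occurs once for each arc leaving \<open>v\<close> whose edge
  is in \<open>R\<close>.
\<close>

lemma prod_edge_signs:
  assumes "R \<subseteq> edges M"
  shows "(\<Prod>e\<in>R. edge_sign S e) = (\<Prod>v\<in>V. (if v \<in> S then - 1 else 1) ^ degree_in M R v)"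
proof -
  let ?g = "\<lambda>v. if v \<in> S then - 1 else 1 :: real"
  have sub: "\<Union>R \<subseteq> arcs (underlying M)" using assms edge_subset_arcs by blast
  then have fin: "finite (\<Union>R)" by (rule finite_subset) simp
  have "(\<Prod>a\<in>\<Union>R. ?g (src a)) = (prod \<circ> prod) (\<lambda>a. ?g (src a)) R"
  proof (rule prod.Union_disjoint)
    show "\<forall>A\<in>R. finite A" using assms finite_edge by auto
    show "\<forall>A\<in>R. \<forall>B\<in>R. A \<noteq> B \<longrightarrow> A \<inter> B = {}"
      using assms edge_eq_of_arc_mem by blast
  qed
  then have "(\<Prod>e\<in>R. edge_sign S e) = (\<Prod>a\<in>\<Union>R. ?g (src a))"
    by (simp add: edge_sign_def)
  also have "\<dots> = (\<Prod>v\<in>V. \<Prod>a\<in>{a \<in> \<Union>R. src a = v}. ?g (src a))"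
    using fin sub by (intro prod.group[symmetric]) auto
  also have "\<dots> = (\<Prod>v\<in>V. ?g v ^ degree_in M R v)"
  proof (intro prod.cong refl)
    fix v
    have "a \<in> \<Union>R \<longleftrightarrow> {a, arc_rev M a} \<in> R" if "a \<in> arcs (underlying M)" for a
      using assms edge_eq_of_arc_mem by blast
    then have "{a \<in> \<Union>R. src a = v} = {a \<in> out_arcs (underlying M) v. {a, arc_rev M a} \<in> R}"
      using sub by auto
    then have "card {a \<in> \<Union>R. src a = v} = degree_in M R v" by (simp add: degree_in_def)
    moreover have "(\<Prod>a\<in>{a \<in> \<Union>R. src a = v}. ?g (src a)) = (\<Prod>a\<in>{a \<in> \<Union>R. src a = v}. ?g v)"
      by (intro prod.cong) auto
    ultimately show "(\<Prod>a\<in>{a \<in> \<Union>R. src a = v}. ?g (src a)) = ?g v ^ degree_in M R v"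
      by (simp only: prod_constant)
  qed
  finally show ?thesis .
qed

text \<open>
  Both sides are the sum over all spin configurations of \<open>\<Prod>e. 1 + y e * edge_sign S e\<close>. On the
  left each factor with sign \<open>- 1\<close> is written as \<open>(1 + y e) * ((1 - y e) / (1 + y e))\<close>; on the
  right the product is expanded and summed over the spins first.
\<close>

lemma high_temperature_expansion:
  fixes y :: "'b set \<Rightarrow> real"
  assumes y: "\<And>e. e \<in> edges M \<Longrightarrow> 1 + y e \<noteq> 0"
  shows "(\<Prod>e\<in>edges M. 1 + y e) * (\<Sum>S\<in>Pow V. \<Prod>e\<in>cut S. (1 - y e) / (1 + y e))
    = 2 ^ card V * (\<Sum>R\<in>polygon_configs M. \<Prod>e\<in>R. y e)"
proof -
  let ?E = "edges M"
  have weight: "(\<Prod>e\<in>?E. 1 + y e) * (\<Prod>e\<in>cut S. (1 - y e) / (1 + y e))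
      = (\<Sum>R\<in>Pow ?E. (\<Prod>e\<in>R. y e) * (\<Prod>e\<in>R. edge_sign S e))" for S
  proof -
    have "(\<Prod>e\<in>cut S. (1 - y e) / (1 + y e))
        = (\<Prod>e\<in>?E. if e \<in> cut S then (1 - y e) / (1 + y e) else 1)"
      using finite_edges by (subst prod.inter_restrict[symmetric]) (auto simp: cut_def intro: prod.cong)
    then have "(\<Prod>e\<in>?E. 1 + y e) * (\<Prod>e\<in>cut S. (1 - y e) / (1 + y e))
        = (\<Prod>e\<in>?E. (1 + y e) * (if e \<in> cut S then (1 - y e) / (1 + y e) else 1))"
      by (simp add: prod.distrib)
    also have "\<dots> = (\<Prod>e\<in>?E. y e * edge_sign S e + 1)"
      using y by (intro prod.cong) (auto simp: edge_sign_eq)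
    also have "\<dots> = (\<Sum>R\<in>Pow ?E. \<Prod>e\<in>R. y e * edge_sign S e)"
      using finite_edges by (simp add: prod_add)
    finally show ?thesis by (simp add: prod.distrib)
  qed
  have "(\<Prod>e\<in>?E. 1 + y e) * (\<Sum>S\<in>Pow V. \<Prod>e\<in>cut S. (1 - y e) / (1 + y e))
      = (\<Sum>S\<in>Pow V. \<Sum>R\<in>Pow ?E. (\<Prod>e\<in>R. y e) * (\<Prod>e\<in>R. edge_sign S e))"
    by (simp only: sum_distrib_left weight)
  also have "\<dots> = (\<Sum>R\<in>Pow ?E. (\<Prod>e\<in>R. y e) * (\<Sum>S\<in>Pow V. \<Prod>e\<in>R. edge_sign S e))"
    by (subst sum.swap) (simp only: sum_distrib_left)
  also have "\<dots> = (\<Sum>R\<in>Pow ?E. if R \<in> polygon_configs M then 2 ^ card V * (\<Prod>e\<in>R. y e) else 0)"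
  proof (intro sum.cong refl)
    fix R assume R: "R \<in> Pow ?E"
    then have "(\<Sum>S\<in>Pow V. \<Prod>e\<in>R. edge_sign S e)
        = (if \<forall>v\<in>V. even (degree_in M R v) then 2 ^ card V else 0)"
      by (simp add: prod_edge_signs sum_sign_powers)
    with R show "(\<Prod>e\<in>R. y e) * (\<Sum>S\<in>Pow V. \<Prod>e\<in>R. edge_sign S e)
        = (if R \<in> polygon_configs M then 2 ^ card V * (\<Prod>e\<in>R. y e) else 0)"
      by (simp add: polygon_configs_def)
  qed
  also have "\<dots> = (\<Sum>R\<in>polygon_configs M. 2 ^ card V * (\<Prod>e\<in>R. y e))"
    using finite_edges
    by (subst sum.inter_restrict[symmetric]) (auto simp: polygon_configs_def intro: sum.cong)
  finally show ?thesis by (simp add: sum_distrib_left)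
qed

section \<open>The weight as a sum over a single configuration\<close>

text \<open>
  The first configuration determines the second as \<open>sym_diff R P\<close>, which has the same homology
  class since \<open>P\<close> is a boundary. Hence the constraint on the classes is automatic, and the sum
  over \<open>\<epsilon>\<close> only partitions the polygon configurations by their class.
\<close>

lemma W_Mono_single_sum:
  assumes "P \<in> polygon_configs M" "P \<in> boundaries M"
  shows "W_Mono M J P = (\<Sum>R\<in>polygon_configs M.
    (2 * (\<Prod>e\<in>edges M. exp (J e)))\<^sup>2
      * (\<Prod>e\<in>R. exp (- 2 * J e)) * (\<Prod>e\<in>sym_diff R P. exp (- 2 * J e)))"
    (is "_ = sum ?w _")
proof -
  let ?Z = "polygon_configs M"
  let ?f = "\<lambda>R R'. (2 * (\<Prod>e\<in>edges M. exp (J e)))\<^sup>2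
      * (\<Prod>e\<in>R. exp (- 2 * J e)) * (\<Prod>e\<in>R'. exp (- 2 * J e))"
  have "(\<Sum>(R, R') \<in> {(R, R') \<in> polygons_of_class M \<epsilon> \<times> polygons_of_class M \<epsilon>.
        monochromatic R R' = P}. ?f R R') = (\<Sum>R\<in>{R \<in> ?Z. homology_class M R = \<epsilon>}. ?w R)" for \<epsilon>
  proof (rule sum.reindex_bij_witness[where i = "\<lambda>R. (R, sym_diff R P)" and j = fst])
    fix p assume p: "p \<in> {(R, R') \<in> polygons_of_class M \<epsilon> \<times> polygons_of_class M \<epsilon>.
      monochromatic R R' = P}"
    then obtain R R' where RR': "p = (R, R')" "R \<in> polygons_of_class M \<epsilon>"
      "R' \<in> polygons_of_class M \<epsilon>" "sym_diff R R' = P"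
      by (auto simp: monochromatic_def)
    then have R': "sym_diff R P = R'" by auto
    then show "(fst p, sym_diff (fst p) P) = p" by (simp add: RR')
    show "fst p \<in> {R \<in> ?Z. homology_class M R = \<epsilon>}"
      using RR' by (simp add: polygons_of_class_def)
    show "?w (fst p) = (case p of (R, R') \<Rightarrow> ?f R R')" using R' by (simp add: RR')
  next
    fix R assume R: "R \<in> {R \<in> ?Z. homology_class M R = \<epsilon>}"
    have "sym_diff R (sym_diff R P) = P" by auto
    moreover have "sym_diff R P \<in> ?Z"
      using R assms by (intro sym_diff_in_polygon_configs) auto
    ultimately show "(R, sym_diff R P) \<in> {(R, R') \<in> polygons_of_class M \<epsilon> \<times> polygons_of_class M \<epsilon>.
        monochromatic R R' = P}"
      using R homology_class_sym_diff_boundary[OF assms(2), of R]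
      by (simp add: polygons_of_class_def monochromatic_def)
  qed simp
  then have "W_Mono M J P
      = (\<Sum>\<epsilon>\<in>homology_class M ` ?Z. \<Sum>R\<in>{R \<in> ?Z. homology_class M R = \<epsilon>}. ?w R)"
    unfolding W_Mono_def carrier_H1 dual_edge_def by (intro sum.cong refl)
  also have "\<dots> = sum ?w ?Z"
    using finite_polygon_configs by (rule sum.image_gen[symmetric])
  finally show ?thesis .
qed

end

section \<open>Monochromatic configurations and dual polygon configurations\<close>

theorem proposition13:
  fixes M :: "('a, 'b) rotation_system"
    and g :: nat
    and J :: "'b set \<Rightarrow> real"
    and P :: "'b set set"
  assumes "cellularly_embedded M"
    and "has_genus M g"
    and "\<And>f. f \<in> edges (dual_map M) \<Longrightarrow> J f > 0"
    and "P \<in> polygons_of_class M \<one>\<^bsub>H1 M\<^esub>"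
  shows "W_Mono M J P =
    C_Ising M g J
    * (\<Prod>e \<in> P. 2 * exp (- 2 * J (dual_edge e)) / (1 + exp (- 4 * J (dual_edge e))))
    * (\<Sum>Q \<in> {Q \<in> polygons_of_class (dual_map M) \<one>\<^bsub>H1 (dual_map M)\<^esub>.
               \<not> (\<exists>e \<in> P. dual_edge e \<in> Q)}.
         \<Prod>f \<in> Q. (1 - exp (- 4 * J f)) / (1 + exp (- 4 * J f)))"
proof -
  interpret cellular_embedding M using assms(1) by unfold_locales
  let ?E = "edges M" and ?Z = "polygon_configs M"
  define k where "k e = exp (- 2 * J e)" for e
  define x where "x e = exp (- 4 * J e)" for e
  define y where "y e = (if e \<in> P then 1 else x e)" for e
  define D where "D = (\<Sum>Q \<in> {Q \<in> cut ` Pow V. \<not> (\<exists>e \<in> P. e \<in> Q)}. \<Prod>f \<in> Q. (1 - x f) / (1 + x f))"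
  define Y where "Y = (\<Sum>R\<in>?Z. \<Prod>e\<in>R. y e)"
  have PZ: "P \<in> ?Z" and PB: "P \<in> boundaries M"
    using assms(4) by (auto simp: polygons_of_trivial_class)
  then have PE: "P \<subseteq> ?E" by (simp add: polygon_configs_def)
  have finP: "finite P" using finite_edges PE by (rule finite_subset[rotated])
  have x_pos: "x e > 0" for e by (simp add: x_def)
  have k2: "k e ^ 2 = x e" for e by (simp add: k_def x_def exp_double[symmetric])
  have x_ne: "1 + x e \<noteq> 0" for e using x_pos[of e] by simp
  have y_ne: "1 + y e \<noteq> 0" for e using x_pos[of e] by (simp add: y_def)

  \<comment> \<open>Setting \<open>y = 1\<close> on \<open>P\<close> turns the product over \<open>R - P\<close> into a product over \<open>R\<close>.\<close>
  have "W_Mono M J P = 4 * (\<Prod>e\<in>?E. exp (J e))\<^sup>2 * prod k P * Y"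
  proof -
    have "(\<Prod>e\<in>R. k e) * (\<Prod>e\<in>sym_diff R P. k e) = prod k P * (\<Prod>e\<in>R. y e)" if "R \<in> ?Z" for R
    proof -
      have finR: "finite R"
        using that finite_edges by (auto simp: polygon_configs_def intro: finite_subset)
      have "(\<Prod>e\<in>R. y e) = (\<Prod>e\<in>R - P. y e)"
        using finR by (intro prod.mono_neutral_right) (auto simp: y_def)
      also have "\<dots> = (\<Prod>e\<in>R - P. k e ^ 2)" by (intro prod.cong) (auto simp: y_def k2)
      finally show ?thesis using prod_times_prod_sym_diff[OF finR finP] by simp
    qed
    then have "W_Mono M J P = (\<Sum>R\<in>?Z. (2 * (\<Prod>e\<in>?E. exp (J e)))\<^sup>2 * (prod k P * (\<Prod>e\<in>R. y e)))"
      unfolding W_Mono_single_sum[OF PZ PB] k_def[symmetric] mult.assoc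
      by (intro sum.cong refl) simp
    then show ?thesis by (simp add: Y_def sum_distrib_left[symmetric] power_mult_distrib mult.assoc)
  qed
  \<comment> \<open>A cut containing an edge of \<open>P\<close> has a factor \<open>(1 - 1) / (1 + 1)\<close>; the factor 2 counts the
    vertex sets of a cut.\<close>
  moreover have "2 ^ card V * Y = (\<Prod>e\<in>?E. 1 + y e) * (2 * D)"
  proof -
    have "(\<Sum>Q\<in>cut ` Pow V. \<Prod>e\<in>Q. (1 - y e) / (1 + y e)) = D"
      unfolding D_def
    proof (intro sum.mono_neutral_cong_right ballI)
      show "finite (cut ` Pow V)" by simp
      fix Q assume "Q \<in> cut ` Pow V - {Q \<in> cut ` Pow V. \<not> (\<exists>e \<in> P. e \<in> Q)}"
      then obtain e where "e \<in> P" "e \<in> Q" "Q \<subseteq> ?E" by (auto simp: cut_def)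
      then show "(\<Prod>e\<in>Q. (1 - y e) / (1 + y e)) = 0"
        using finite_subset[OF _ finite_edges] by (intro prod_zero) (auto simp: y_def)
    next
      fix Q assume "Q \<in> {Q \<in> cut ` Pow V. \<not> (\<exists>e \<in> P. e \<in> Q)}"
      then show "(\<Prod>e\<in>Q. (1 - y e) / (1 + y e)) = (\<Prod>e\<in>Q. (1 - x e) / (1 + x e))"
        by (intro prod.cong) (auto simp: y_def)
    qed auto
    then show ?thesis
      using high_temperature_expansion[of y] sum_over_cuts[of "\<lambda>Q. \<Prod>e\<in>Q. (1 - y e) / (1 + y e)"] y_ne
      by (simp add: Y_def)
  qed
  \<comment> \<open>Passing from \<open>y\<close> to \<open>x\<close> replaces \<open>1 + x e\<close> by 2 on \<open>P\<close>, and
    \<open>exp (2 * J e) * (1 + x e) = 2 * cosh (2 * J e)\<close>.\<close>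
  moreover have "(\<Prod>e\<in>?E. exp (J e))\<^sup>2 * prod k P * (\<Prod>e\<in>?E. 1 + y e)
      = 2 ^ card ?E * (\<Prod>e\<in>?E. cosh (2 * J e)) * (\<Prod>e\<in>P. 2 * k e / (1 + x e))"
  proof -
    have "(\<Prod>e\<in>?E. 1 + y e) = (\<Prod>e\<in>?E. (1 + x e) * (if e \<in> P then 2 / (1 + x e) else 1))"
      using y_ne by (intro prod.cong) (auto simp: y_def x_ne divide_eq_eq)
    also have "\<dots> = (\<Prod>e\<in>?E. 1 + x e) * (\<Prod>e\<in>P. 2 / (1 + x e))"
      using finite_edges PE
      by (simp add: prod.distrib prod.inter_restrict[symmetric] Int_absorb1)
    finally have "(\<Prod>e\<in>?E. 1 + y e) = (\<Prod>e\<in>?E. 1 + x e) * (\<Prod>e\<in>P. 2 / (1 + x e))" .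
    moreover have "(\<Prod>e\<in>?E. exp (J e))\<^sup>2 * (\<Prod>e\<in>?E. 1 + x e) = (\<Prod>e\<in>?E. 2 * cosh (2 * J e))"
    proof -
      have "exp (J e) ^ 2 * (1 + x e) = 2 * cosh (2 * J e)" for e
        by (simp add: x_def cosh_field_def distrib_left exp_double[symmetric] exp_add[symmetric])
      then show ?thesis by (simp add: prod_power_distrib prod.distrib[symmetric])
    qed
    moreover have "(\<Prod>e\<in>P. 2 * k e / (1 + x e)) = prod k P * (\<Prod>e\<in>P. 2 / (1 + x e))"
      by (simp add: prod.distrib[symmetric] mult.commute)
    ultimately show ?thesis by (simp add: prod.distrib algebra_simps)
  qed
  \<comment> \<open>Euler's formula. The 8 is the square of the prefactor 2 of the Ising partition function
    times the number of vertex sets with a given cut.\<close>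
  moreover have "8 * 2 ^ card ?E = (2 ^ (card (faces M) + 2 * g + 1) * 2 ^ card V :: real)"
  proof -
    have "card ?E + 3 = card (faces M) + 2 * g + 1 + card V"
      using assms(2) by (simp add: has_genus_def euler_char_def)
    then have "2 ^ (card ?E + 3) = (2 ^ (card (faces M) + 2 * g + 1 + card V) :: real)" by (simp only:)
    then show ?thesis by (simp only: power_add) simp
  qed
  ultimately have "2 ^ card V * W_Mono M J P
      = 2 ^ card V * (C_Ising M g J * (\<Prod>e\<in>P. 2 * k e / (1 + x e)) * D)"
  proof -
    assume W: "W_Mono M J P = 4 * (\<Prod>e\<in>?E. exp (J e))\<^sup>2 * prod k P * Y"
      and Y: "2 ^ card V * Y = (\<Prod>e\<in>?E. 1 + y e) * (2 * D)"
      and prods: "(\<Prod>e\<in>?E. exp (J e))\<^sup>2 * prod k P * (\<Prod>e\<in>?E. 1 + y e)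
        = 2 ^ card ?E * (\<Prod>e\<in>?E. cosh (2 * J e)) * (\<Prod>e\<in>P. 2 * k e / (1 + x e))"
      and euler: "8 * 2 ^ card ?E = (2 ^ (card (faces M) + 2 * g + 1) * 2 ^ card V :: real)"
    have "2 ^ card V * W_Mono M J P
        = 4 * ((\<Prod>e\<in>?E. exp (J e))\<^sup>2 * prod k P) * (2 ^ card V * Y)"
      by (simp add: W)
    also have "\<dots> = 8 * ((\<Prod>e\<in>?E. exp (J e))\<^sup>2 * prod k P * (\<Prod>e\<in>?E. 1 + y e)) * D"
      unfolding Y by simp
    also have "\<dots> = (8 * 2 ^ card ?E) * (\<Prod>e\<in>?E. cosh (2 * J e))
        * (\<Prod>e\<in>P. 2 * k e / (1 + x e)) * D"
      unfolding prods by simp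
    also have "\<dots> = 2 ^ card V * (C_Ising M g J * (\<Prod>e\<in>P. 2 * k e / (1 + x e)) * D)"
      unfolding euler by (simp add: C_Ising_def dual_map_def dual_edge_def)
    finally show ?thesis .
  qed
  then have "W_Mono M J P = C_Ising M g J * (\<Prod>e\<in>P. 2 * k e / (1 + x e)) * D" by simp
  then show ?thesis
    unfolding trivial_dual_polygons by (simp only: D_def k_def x_def dual_edge_def)
qed

end
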